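(* Let $\sigma'=s_{k'_0}\cdots s_{k'_{N'-1}}r_{m'}$ and $\sigma''=s_{k''_0}\cdots s_{k''_{N''-1}}r_{m''}$ be two simple sequences. Then, denoting by $\sigma=\sigma'\sigma''$ the sequence obtained by concatenation of $\sigma'$ and $\sigma''$, we have with $N=N'+N''$ $$\Delta_{\sigma'\sigma''}(X_0,\dots,X_{N-1})=\Delta_{\sigma'}(X_0,\dots,X_{N'-1})\,\Delta_{\sigma''}(X_{N'},\dots,X_{N'+N''-1}).$$
   Context: For $k\ge1$ the singular sequence $s_k$ is $(k+2,2,\dots,2)$ (length $k$); for $m\ge1$ the regular sequence $r_m$ is $(2,\dots,2)$ (length $m$). A simple sequence is a sequence of the form $s_{k_0}\cdots s_{k_{q-1}}r_m$ with $q\ge1$. Let $\tau$ be a concatenation of simple sequences with, in total, $N$ singular sequences, numbered $0,\dots,N-1$ in order; $A(\tau)\subset\mathbb Z/N\mathbb Z$ is the set of indices $j$ such that the $j$-th singular sequence is immediately followed by a regular sequence. Let $N\ge1$ and $A=\{a_1,\dots,a_p\}\subset\mathbb Z/N\mathbb Z$ with $0\le a_1<\dots<a_p\le N-1$. Define a partition of $\mathbb Z/N\mathbb Z$ into blocks by $A_1=\{k\mid 0\le k\le a_1 \text{ or } a_p<k\le N-1\}$ and $A_i=\{k\mid a_{i-1}<k\le a_i\}$ for $2\le i\le p$; if $A=\emptyset$ the only block is $A_1=\mathbb Z/N\mathbb Z$. A proper subset $B\subsetneq\mathbb Z/N\mathbb Z$ is generating allowed relatively to $A$ if either $B=\{a\}$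 with $a\in A$, or $B=\{k,k+1\}$ and $B$ is contained in one of the blocks $A_i$; a proper subset is allowed if it admits a (possibly empty) partition into generating allowed subsets; $\mathcal P_A$ is the set of allowed subsets, and $P_A(X_0,\dots,X_{N-1})=\sum_{B\in\mathcal P_A}\prod_{i\notin B}X_i$. Put $\Delta_\tau(X_0,\dots,X_{N-1})=P_{A(\tau)}(X_0,\dots,X_{N-1})+1$.
   Formalization: A pair {k,k+1} is generating allowed only if also k is not in A; this matters only when A={a}, where it excludes {a,a+1}. Otherwise the identity fails, e.g. for N'=3, N''=1 (coefficient of X_1X_3). *)

theory Defs
  imports "HOL-Library.Poly_Mapping" "HOL-Library.Disjoint_Sets"
begin

section \<open>Singular, regular and simple sequences\<close>

definition sing_seq :: "nat \<Rightarrow> nat list" where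
  "sing_seq k = (k + 2) # replicate (k - 1) 2"

definition reg_seq :: "nat \<Rightarrow> nat list" where
  "reg_seq m = replicate m 2"

definition simple_seq :: "nat list \<Rightarrow> nat \<Rightarrow> nat list" where
  "simple_seq ks m = concat (map sing_seq ks) @ reg_seq m"

datatype piece = is_sing: Sing nat | Reg nat

fun piece_seq :: "piece \<Rightarrow> nat list" where
  "piece_seq (Sing k) = sing_seq k"
| "piece_seq (Reg m) = reg_seq m"

definition simple_pieces :: "piece list \<Rightarrow> bool" where
  "simple_pieces ps \<longleftrightarrow>
     (\<exists>ks m. ks \<noteq> [] \<and> (\<forall>k\<in>set ks. 1 \<le> k) \<and> 1 \<le> m \<and> ps = map Sing ks @ [Reg m])"

definition factorization :: "nat list \<Rightarrow> piece list \<Rightarrow> bool" where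
  "factorization \<tau> ps \<longleftrightarrow>
     (\<exists>pss. pss \<noteq> [] \<and> (\<forall>qs\<in>set pss. simple_pieces qs) \<and> ps = concat pss) \<and>
     \<tau> = concat (map piece_seq ps)"

text \<open>
  The decomposition of a sequence of integers into singular and regular sequences
  is unique (see \<open>factorization_unique\<close> below), so the following is well defined
  on concatenations of simple sequences.
\<close>

definition pieces :: "nat list \<Rightarrow> piece list" where
  "pieces \<tau> = (THE ps. factorization \<tau> ps)"

definition num_sing :: "nat list \<Rightarrow> nat" where
  "num_sing \<tau> = length (filter is_sing (pieces \<tau>))"

definition A_set :: "nat list \<Rightarrow> nat set" where
  "A_set \<tau> = {j. \<exists>i k m. Suc i < length (pieces \<tau>) \<and>
     pieces \<tau> ! i = Sing k \<and> pieces \<tau> ! Suc i = Reg m \<and>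
     j = length (filter is_sing (take i (pieces \<tau>)))}"


section \<open>Allowed subsets\<close>

text \<open>
  \<open>\<int>/N\<int>\<close> is represented by \<open>{..<N}\<close>. The blocks are numbered from 0, so that
  \<open>block N A i\<close> is \<open>A\<^sub>i\<^sub>+\<^sub>1\<close>, and \<open>sorted_list_of_set A ! i\<close> is \<open>a\<^sub>i\<^sub>+\<^sub>1\<close>.
\<close>

definition block :: "nat \<Rightarrow> nat set \<Rightarrow> nat \<Rightarrow> nat set" where
  "block N A i =
     (let as = sorted_list_of_set A in
      if i = 0 then {k. k < N \<and> (k \<le> as ! 0 \<or> last as < k)}
      else {k. as ! (i - 1) < k \<and> k \<le> as ! i})"

definition blocks :: "nat \<Rightarrow> nat set \<Rightarrow> nat set set" where
  "blocks N A = (if A = {} then {{..<N}} else block N A ` {..<card A})"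

text \<open>
  If \<open>A\<close> is nonempty, the blocks are the arcs of the cycle \<open>\<int>/N\<int>\<close> obtained by cutting
  it after each element of \<open>A\<close>, and \<open>{k, k+1}\<close> has to lie on such an arc as a pair of
  consecutive elements, i.e. without a cut between \<open>k\<close> and \<open>k+1\<close>. This is what
  \<open>k \<notin> A\<close> says. If \<open>A\<close> does not have exactly one element, this follows from the
  inclusion of the pair in a block (see \<open>pair_in_block_notin\<close> below). If \<open>A = {a}\<close>, the
  only block is the whole of \<open>\<int>/N\<int>\<close> as a set, but as an arc it starts at \<open>a+1\<close> and ends
  at \<open>a\<close>; the pair \<open>{a, a+1}\<close> formed by its two ends must not be admitted: otherwise
  \<open>\<Delta>\<close> would not be multiplicative, e.g. the coefficient of \<open>X\<^sub>1\<close> in \<open>\<Delta>\<close> of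
  a simple sequence with 3 singular sequences would be 1, while the coefficient of
  \<open>X\<^sub>1 X\<^sub>3\<close> in \<open>\<Delta>\<close> of its concatenation with a simple sequence with one singular sequence is 0.
\<close>

definition generating_allowed :: "nat \<Rightarrow> nat set \<Rightarrow> nat set \<Rightarrow> bool" where
  "generating_allowed N A B \<longleftrightarrow> B \<subset> {..<N} \<and>
     ((\<exists>a\<in>A. B = {a}) \<or>
      (\<exists>k<N. k \<notin> A \<and> B = {k, (k + 1) mod N} \<and> (\<exists>C\<in>blocks N A. B \<subseteq> C)))"

definition allowed :: "nat \<Rightarrow> nat set \<Rightarrow> nat set set" where
  "allowed N A = {B. B \<subset> {..<N} \<and>
     (\<exists>P. partition_on B P \<and> (\<forall>C\<in>P. generating_allowed N A C))}"


section \<open>The polynomials\<close>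

text \<open>
  \<open>P_poly N A Y\<close> is \<open>P\<^sub>A(Y 0, ..., Y (N-1))\<close>. The arguments are elements of
  any commutative ring; the polynomial itself is obtained for \<open>Y = indet\<close>.
\<close>

definition P_poly :: "nat \<Rightarrow> nat set \<Rightarrow> (nat \<Rightarrow> 'a::comm_ring_1) \<Rightarrow> 'a" where
  "P_poly N A Y = (\<Sum>B\<in>allowed N A. \<Prod>i\<in>{..<N} - B. Y i)"

definition Delta :: "nat list \<Rightarrow> (nat \<Rightarrow> 'a::comm_ring_1) \<Rightarrow> 'a" where
  "Delta \<tau> Y = P_poly (num_sing \<tau>) (A_set \<tau>) Y + 1"

definition indet :: "nat \<Rightarrow> (nat \<Rightarrow>\<^sub>0 nat) \<Rightarrow>\<^sub>0 int" where
  "indet i = Poly_Mapping.single (Poly_Mapping.single i 1) 1"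


section \<open>Well-definedness\<close>

fun separated :: "piece list \<Rightarrow> bool" where
  "separated [] \<longleftrightarrow> True"
| "separated (Sing k # ps) \<longleftrightarrow> 1 \<le> k \<and> separated ps"
| "separated (Reg m # ps) \<longleftrightarrow> 1 \<le> m \<and> (ps = [] \<or> is_sing (hd ps)) \<and> separated ps"

lemma separated_append:
  assumes "separated ps" "separated qs" "qs = [] \<or> is_sing (hd qs)"
  shows "separated (ps @ qs)"
  using assms by (induction ps rule: separated.induct) (auto simp: hd_append)

lemma separated_simple:
  assumes "simple_pieces ps"
  shows "separated ps \<and> ps \<noteq> [] \<and> is_sing (hd ps)"
proof -
  obtain ks m where *: "ks \<noteq> []" "\<forall>k\<in>set ks. 1 \<le> k" "1 \<le> m" "ps = map Sing ks @ [Reg m]"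
    using assms unfolding simple_pieces_def by blast
  have "separated (map Sing ks @ [Reg m])" using *(2,3) by (induction ks) auto
  with * show ?thesis by (cases ks) auto
qed

lemma separated_concat:
  assumes "\<forall>qs\<in>set pss. simple_pieces qs"
  shows "separated (concat pss) \<and> (concat pss = [] \<or> is_sing (hd (concat pss)))"
  using assms
proof (induction pss)
  case (Cons ps pss)
  then show ?case using separated_simple[of ps] by (auto intro: separated_append)
qed simp

lemma takeWhile_Reg:
  assumes "separated (Reg m # ps)"
  shows "takeWhile (\<lambda>x. x = 2) (concat (map piece_seq (Reg m # ps))) = replicate m 2"
proof (cases ps)
  case Nil
  then show ?thesis by (simp add: reg_seq_def takeWhile_eq_all_conv)
next
  case (Cons p qs)
  then obtain k where "p = Sing k" "1 \<le> k" using assms by (cases p) auto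
  then show ?thesis using Cons
    by (simp add: reg_seq_def sing_seq_def takeWhile_append)
qed

lemma separated_inj:
  assumes "separated ps" "separated qs"
    and "concat (map piece_seq ps) = concat (map piece_seq qs)"
  shows "ps = qs"
  using assms
proof (induction ps arbitrary: qs)
  case Nil
  show ?case
  proof (cases qs)
    case (Cons q rs)
    then show ?thesis using Nil by (cases q) (auto simp: sing_seq_def reg_seq_def)
  qed simp
next
  case (Cons p ps)
  have ne: "concat (map piece_seq (p # ps)) \<noteq> []"
    using Cons.prems(1) by (cases p) (auto simp: sing_seq_def reg_seq_def)
  then obtain q rs where qs: "qs = q # rs" using Cons.prems(3) by (cases qs) auto
  have heads: "hd (concat (map piece_seq (x # xs))) = (case x of Sing k \<Rightarrow> k + 2 | Reg m \<Rightarrow> 2)"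
    if "separated (x # xs)" for x xs
    using that by (cases x) (auto simp: sing_seq_def reg_seq_def hd_append)
  have hd_eq: "(case p of Sing k \<Rightarrow> k + 2 | Reg m \<Rightarrow> 2) = (case q of Sing k \<Rightarrow> k + 2 | Reg m \<Rightarrow> 2)"
    using heads[of p ps] heads[of q rs] Cons.prems qs by simp
  have "p = q"
  proof (cases p)
    case (Sing k)
    then show ?thesis using hd_eq Cons.prems(1) by (cases q) auto
  next
    case (Reg m)
    then obtain m' where q: "q = Reg m'" using hd_eq Cons.prems(2) qs by (cases q) auto
    have "replicate m (2::nat) = replicate m' 2"
      using takeWhile_Reg[of m ps] takeWhile_Reg[of m' rs] Cons.prems Reg q qs by simp
    then show ?thesis using Reg q by (metis length_replicate)
  qed
  moreover have "ps = rs"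
  proof (rule Cons.IH)
    show "separated ps" using Cons.prems(1) by (cases p) auto
    show "separated rs" using Cons.prems(2) qs by (cases q) auto
    show "concat (map piece_seq ps) = concat (map piece_seq rs)"
      using Cons.prems(3) qs \<open>p = q\<close> by simp
  qed
  ultimately show ?case using qs by simp
qed

lemma factorization_unique:
  assumes "factorization \<tau> ps" "factorization \<tau> qs"
  shows "ps = qs"
  using assms separated_concat separated_inj unfolding factorization_def by metis

lemma pieces_eq: "factorization \<tau> ps \<Longrightarrow> pieces \<tau> = ps"
  unfolding pieces_def using factorization_unique by blast

lemma factorization_simple_append:
  assumes "ks \<noteq> []" "\<forall>k\<in>set ks. 1 \<le> k" "1 \<le> m"
    and "ls \<noteq> []" "\<forall>k\<in>set ls. 1 \<le> k" "1 \<le> n"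
  shows "factorization (simple_seq ks m) (map Sing ks @ [Reg m])"
    and "factorization (simple_seq ks m @ simple_seq ls n)
           (map Sing ks @ [Reg m] @ map Sing ls @ [Reg n])"
proof -
  have simple: "simple_pieces (map Sing ks @ [Reg m])" "simple_pieces (map Sing ls @ [Reg n])"
    using assms unfolding simple_pieces_def by blast+
  have eq: "piece_seq \<circ> Sing = sing_seq" by auto
  show "factorization (simple_seq ks m) (map Sing ks @ [Reg m])"
    unfolding factorization_def using simple(1)
    by (intro conjI exI[of _ "[map Sing ks @ [Reg m]]"]) (auto simp: simple_seq_def eq)
  show "factorization (simple_seq ks m @ simple_seq ls n)
          (map Sing ks @ [Reg m] @ map Sing ls @ [Reg n])"
    unfolding factorization_def using simple
    by (intro conjI exI[of _ "[map Sing ks @ [Reg m], map Sing ls @ [Reg n]]"])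
       (auto simp: simple_seq_def eq)
qed

lemma num_sing_simple_append:
  assumes "ks \<noteq> []" "\<forall>k\<in>set ks. 1 \<le> k" "1 \<le> m"
    and "ls \<noteq> []" "\<forall>k\<in>set ls. 1 \<le> k" "1 \<le> n"
  shows "num_sing (simple_seq ks m) = length ks"
    and "num_sing (simple_seq ks m @ simple_seq ls n) = length ks + length ls"
  using pieces_eq[OF factorization_simple_append(1)[OF assms]]
    pieces_eq[OF factorization_simple_append(2)[OF assms]]
  by (simp_all add: num_sing_def filter_map comp_def)

lemma pair_in_block_notin:
  assumes "A \<subseteq> {..<N}" "card A \<noteq> 1" "k < N"
    and "C \<in> blocks N A" "{k, (k + 1) mod N} \<subseteq> C"
  shows "k \<notin> A"
proof
  assume kA: "k \<in> A"
  have fin: "finite A" using assms(1) finite_subset by blast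
  define as where "as = sorted_list_of_set A"
  have len: "length as = card A" and set: "set as = A" and sw: "sorted_wrt (<) as"
    using fin by (auto simp: as_def)
  have p: "2 \<le> card A" using kA fin assms(2)
    by (metis One_nat_def Suc_leI card_gt_0_iff empty_iff le_antisym not_less_eq_eq numeral_2_eq_2)
  have last: "last as = as ! (card A - 1)"
    using len p by (metis last_conv_nth list.size(3) not_numeral_le_zero)
  have less: "as ! i < as ! j" if "i < j" "j < card A" for i j
    using sorted_wrt_nth_less[OF sw] that len by simp
  have le: "as ! i \<le> as ! j" if "i \<le> j" "j < card A" for i j
    using less[of i j] that by (cases "i = j") auto
  obtain i where i: "i < card A" "C = block N A i"
    using assms(4) kA unfolding blocks_def by (auto split: if_splits)
  obtain l where l: "l < card A" "k = as ! l" using kA set len by (metis in_set_conv_nth)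
  have k1: "(k + 1) mod N = (if k + 1 = N then 0 else k + 1)" using assms(3) by auto
  have kC: "k \<in> C" "(k + 1) mod N \<in> C" using assms(5) by auto
  show False
  proof (cases "i = 0")
    case True
    have "k \<le> as ! 0 \<or> as ! (card A - 1) < k"
      using kC(1) i True last by (auto simp: block_def as_def Let_def)
    moreover have "k \<le> as ! (card A - 1)" using le[of l "card A - 1"] l by auto
    moreover have "as ! 0 \<le> k" using le[of 0 l] l by auto
    ultimately have k0: "k = as ! 0" by linarith
    then have lt: "k < as ! (card A - 1)" using less[of 0 "card A - 1"] p by auto
    have "as ! (card A - 1) \<in> A" using nth_mem[of "card A - 1" as] set len p by simp
    then have "as ! (card A - 1) < N" using assms(1) by auto
    then have "(k + 1) mod N = k + 1" using lt by auto
    then have "k + 1 \<le> as ! 0 \<or> as ! (card A - 1) < k + 1"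
      using kC(2) i True last by (auto simp: block_def as_def Let_def)
    then show False using k0 lt by linarith
  next
    case False
    have a: "as ! (i - 1) < k" "k \<le> as ! i" "as ! (i - 1) < (k + 1) mod N" "(k + 1) mod N \<le> as ! i"
      using kC i False by (auto simp: block_def as_def Let_def)
    have "i \<le> l"
    proof (rule ccontr)
      assume "\<not> i \<le> l"
      then have "l \<le> i - 1" "i - 1 < card A" using i(1) by linarith+
      then show False using a(1) le[of l "i - 1"] l(2) by linarith
    qed
    then have "k = as ! i" using le[of i l] l a(2) by auto
    then show False using a k1 by (auto split: if_splits)
  qed
qed

end

theory Submission
  imports Defs
begin

text \<open>
  Suppose that the last index \<open>N - 1\<close> belongs to \<open>A\<close>, as happens for every concatenation of
  simple sequences. Then cutting the cycle \<open>\<int>/N\<int>\<close> after each element of \<open>A\<close> cuts it in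
  particular between \<open>N - 1\<close> and \<open>0\<close>, and what remains is a segment in which the generating
  allowed subsets are certain cells: the singletons \<open>{a}\<close> with \<open>a \<in> A\<close>, and the pairs \<open>{k, k+1}\<close>
  without a cut between \<open>k\<close> and \<open>k+1\<close>. So the allowed subsets are the proper subsets that can be
  tiled by cells.

  The whole segment can be tiled as well: walk through it from the left, covering the next index
  \<open>k\<close> by the singleton if \<open>k \<in> A\<close> and by \<open>{k, k+1}\<close> otherwise; the walk cannot overrun the end
  because \<open>N - 1 \<in> A\<close>. The whole segment has an empty complement, so it would contribute the
  monomial \<open>1\<close>. This is the summand \<open>+ 1\<close> in \<open>\<Delta>\<close>: restoring the tiling that properness excludes
  makes \<open>\<Delta>\<close> the sum over \<^emph>\<open>all\<close> tilable subsets (\<open>Delta_eq_tiling_sum\<close>).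

  Without the properness condition, multiplicativity is clear. In the concatenation of \<open>\<sigma>'\<close> and
  \<open>\<sigma>''\<close> the index \<open>N' - 1\<close> lies in \<open>A\<close>, so no cell crosses from \<open>{..<N'}\<close> to \<open>{N'..<N}\<close>. A tilable
  subset is therefore the union of a tilable subset of the first segment and a tilable subset of
  the second, chosen independently (\<open>tilable_add_iff\<close>), and the sum factors.
\<close>

section \<open>Tilings of a segment\<close>

definition cells :: "nat \<Rightarrow> nat set \<Rightarrow> nat set set" where
  "cells N A = {{a} | a. a \<in> A} \<union> {{k, k + 1} | k. k \<notin> A \<and> k + 1 < N}"

definition tilable :: "nat \<Rightarrow> nat set \<Rightarrow> nat set set" where
  "tilable N A = {B. B \<subseteq> {..<N} \<and> (\<exists>P. partition_on B P \<and> P \<subseteq> cells N A)}"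

lemma finite_tilable: "finite (tilable N A)"
  by (rule finite_subset[of _ "Pow {..<N}"]) (auto simp: tilable_def)

lemma tilable_empty: "{} \<in> tilable N A"
  unfolding tilable_def by (auto intro!: exI[of _ "{}"] simp: partition_on_def)

lemma tilable_Un:
  assumes "B \<in> tilable N A" "C \<in> tilable N A" "B \<inter> C = {}"
  shows "B \<union> C \<in> tilable N A"
proof -
  obtain P Q where "B \<subseteq> {..<N}" "C \<subseteq> {..<N}" "partition_on B P" "partition_on C Q"
    "P \<subseteq> cells N A" "Q \<subseteq> cells N A"
    using assms(1,2) unfolding tilable_def by blast
  moreover from this have "partition_on (B \<union> C) (P \<union> Q)"
    using assms(3) unfolding partition_on_def by (auto intro: disjoint_union)
  ultimately show ?thesis unfolding tilable_def by blast
qed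

lemma tilable_cell:
  assumes "c \<in> cells N A" "c \<subseteq> {..<N}"
  shows "c \<in> tilable N A"
proof -
  have "partition_on c {c}" using assms(1) by (intro partition_on_space) (auto simp: cells_def)
  then show ?thesis using assms unfolding tilable_def by blast
qed

text \<open>
  The greedy tiling from the left. The membership \<open>N - 1 \<in> A\<close> is what guarantees that the pair
  chosen at an index outside \<open>A\<close> still fits.
\<close>

lemma tilable_final_segment:
  assumes "A \<subseteq> {..<N}" "N - 1 \<in> A" "l \<le> N"
  shows "{l..<N} \<in> tilable N A"
  using assms(3)
proof (induction "N - l" arbitrary: l rule: less_induct)
  case less
  consider "l = N" | "l < N" "l \<in> A" | "l < N" "l \<notin> A" using less.prems by linarith
  then show ?case
  proof cases
    case 1
    then show ?thesis by (simp add: tilable_empty)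
  next
    case 2
    then have "{l} \<in> tilable N A" by (intro tilable_cell) (auto simp: cells_def)
    moreover have "{Suc l..<N} \<in> tilable N A" using less.hyps[of "Suc l"] 2 by simp
    moreover have "{l..<N} = {l} \<union> {Suc l..<N}" using 2 by auto
    ultimately show ?thesis using tilable_Un[of "{l}" N A "{Suc l..<N}"] by simp
  next
    case 3
    then have l: "l + 1 < N" using assms(2) by (cases "l = N - 1") auto
    then have "{l, l + 1} \<in> tilable N A" using 3 by (intro tilable_cell) (auto simp: cells_def)
    moreover have "{l + 2..<N} \<in> tilable N A" using less.hyps[of "l + 2"] l by simp
    moreover have "{l..<N} = {l, l + 1} \<union> {l + 2..<N}" using l by auto
    ultimately show ?thesis using tilable_Un[of "{l, l + 1}" N A "{l + 2..<N}"] by auto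
  qed
qed


section \<open>Allowed subsets as proper tilable subsets\<close>

text \<open>
  The block containing \<open>{k, k+1}\<close> is the one that ends at the first element of \<open>A\<close> after \<open>k\<close>.
\<close>

lemma pair_in_some_block:
  assumes "A \<subseteq> {..<N}" "N - 1 \<in> A" "k \<notin> A" "k + 1 < N"
  shows "\<exists>C\<in>blocks N A. {k, k + 1} \<subseteq> C"
proof -
  define as where "as = sorted_list_of_set A"
  have fin: "finite A" using assms(1) finite_subset by blast
  have len: "length as = card A" and set: "set as = A"
    using fin by (auto simp: as_def)
  obtain j where j: "j < card A" "as ! j = N - 1"
    using assms(2) set len by (metis in_set_conv_nth)
  define i where "i = (LEAST i. k \<le> as ! i)"
  have ki: "k \<le> as ! i" unfolding i_def using assms(4) j by (intro LeastI[of "\<lambda>i. k \<le> as ! i" j]) simp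
  have ij: "i \<le> j" unfolding i_def using assms(4) j by (intro Least_le) simp
  then have i: "i < card A" using j by simp
  then have "as ! i \<noteq> k" using assms(3) set len by (metis nth_mem)
  then have ki': "k + 1 \<le> as ! i" using ki by linarith
  have before: "as ! (i - 1) < k" if "i \<noteq> 0"
    using not_less_Least[of "i - 1" "\<lambda>i. k \<le> as ! i"] that unfolding i_def by simp
  have "{k, k + 1} \<subseteq> block N A i"
    using ki ki' before assms(4) by (auto simp: block_def Let_def as_def[symmetric])
  moreover have "block N A i \<in> blocks N A" using i assms(2) by (auto simp: blocks_def)
  ultimately show ?thesis by blast
qed

lemma generating_allowed_iff_cell:
  assumes "A \<subseteq> {..<N}" "N - 1 \<in> A"
  shows "generating_allowed N A B \<longleftrightarrow> B \<subset> {..<N} \<and> B \<in> cells N A"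
proof -
  have "(\<exists>k<N. k \<notin> A \<and> B = {k, (k + 1) mod N} \<and> (\<exists>C\<in>blocks N A. B \<subseteq> C))
      \<longleftrightarrow> (\<exists>k. k \<notin> A \<and> k + 1 < N \<and> B = {k, k + 1})"
  proof (intro iffI; elim exE conjE)
    fix k assume k: "k < N" "k \<notin> A" "B = {k, (k + 1) mod N}"
    then have "k + 1 < N" using assms(2) by (cases "k = N - 1") auto
    then show "\<exists>k. k \<notin> A \<and> k + 1 < N \<and> B = {k, k + 1}" using k by auto
  next
    fix k assume k: "k \<notin> A" "k + 1 < N" "B = {k, k + 1}"
    then show "\<exists>k<N. k \<notin> A \<and> B = {k, (k + 1) mod N} \<and> (\<exists>C\<in>blocks N A. B \<subseteq> C)"
      using pair_in_some_block[OF assms k(1,2)] by (intro exI[of _ k]) auto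
  qed
  moreover have "B \<in> cells N A \<longleftrightarrow>
      (\<exists>a\<in>A. B = {a}) \<or> (\<exists>k. k \<notin> A \<and> k + 1 < N \<and> B = {k, k + 1})"
    unfolding cells_def by blast
  ultimately show ?thesis unfolding generating_allowed_def by simp
qed

text \<open>
  A tile of a proper subset is itself a proper subset, so it suffices to impose properness on
  the union of the tiles.
\<close>

lemma allowed_eq_tilable:
  assumes "A \<subseteq> {..<N}" "N - 1 \<in> A"
  shows "allowed N A = tilable N A - {{..<N}}"
proof -
  have tiles: "(\<forall>C\<in>P. generating_allowed N A C) \<longleftrightarrow> P \<subseteq> cells N A"
    if B: "B \<subset> {..<N}" "partition_on B P" for B P
  proof -
    have "C \<subset> {..<N}" if "C \<in> P" for C
    proof -
      have "C \<subseteq> B" using partition_onD1[OF B(2)] that by (simp add: Union_upper)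
      then show ?thesis using B(1) by (rule subset_psubset_trans)
    qed
    then have "generating_allowed N A C \<longleftrightarrow> C \<in> cells N A" if "C \<in> P" for C
      using generating_allowed_iff_cell[OF assms] that by simp
    then show ?thesis by blast
  qed
  show ?thesis
  proof (rule set_eqI)
    fix B
    show "B \<in> allowed N A \<longleftrightarrow> B \<in> tilable N A - {{..<N}}"
    proof (cases "B \<subset> {..<N}")
      case True
      then show ?thesis using tiles[of B] unfolding allowed_def tilable_def by blast
    next
      case False
      then show ?thesis unfolding allowed_def tilable_def by blast
    qed
  qed
qed


section \<open>The polynomial as a sum over tilable subsets\<close>

definition tiling_sum :: "nat \<Rightarrow> nat set \<Rightarrow> (nat \<Rightarrow> 'a::comm_ring_1) \<Rightarrow> 'a" where
  "tiling_sum N A Y = (\<Sum>B\<in>tilable N A. \<Prod>i\<in>{..<N} - B. Y i)"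

text \<open>
  The constant \<open>1\<close> is the monomial of the full segment, whose complement is empty.
\<close>

lemma P_poly_add_1:
  assumes "A \<subseteq> {..<N}" "N - 1 \<in> A"
  shows "P_poly N A Y + 1 = tiling_sum N A Y"
proof -
  have "{..<N} \<in> tilable N A"
    using tilable_final_segment[OF assms, of 0] by (simp add: lessThan_atLeast0)
  then show ?thesis
    unfolding P_poly_def tiling_sum_def allowed_eq_tilable[OF assms]
    by (simp add: sum.remove[OF finite_tilable] add.commute)
qed


section \<open>Splitting tilings at a cut\<close>

text \<open>
  The shifted set \<open>(+) n ` A''\<close> carries the cuts of the second segment to their place behind the
  first one.
\<close>

lemma cells_add_left:
  assumes "A' \<subseteq> {..<n}"
  shows "cells n A' \<subseteq> cells (n + m) (A' \<union> (+) n ` A'')"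
  using assms by (fastforce simp: cells_def)

lemma cells_add_right:
  assumes "A' \<subseteq> {..<n}"
  shows "(`) ((+) n) ` cells m A'' \<subseteq> cells (n + m) (A' \<union> (+) n ` A'')"
proof
  fix c assume "c \<in> (`) ((+) n) ` cells m A''"
  then consider a where "a \<in> A''" "c = {n + a}"
    | k where "k \<notin> A''" "k + 1 < m" "c = {n + k, n + k + 1}"
    by (auto simp: cells_def)
  then show "c \<in> cells (n + m) (A' \<union> (+) n ` A'')"
  proof cases
    case 2
    then have "n + k \<notin> A' \<union> (+) n ` A''" using assms by auto
    then show ?thesis using 2 by (auto simp: cells_def intro!: exI[of _ "n + k"])
  qed (auto simp: cells_def)
qed

text \<open>
  The only pair that could straddle the boundary is \<open>{n - 1, n}\<close>, and it is not a cell because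
  \<open>n - 1 \<in> A'\<close>.
\<close>

lemma cells_add_cases:
  assumes "A' \<subseteq> {..<n}" "n - 1 \<in> A'" "c \<in> cells (n + m) (A' \<union> (+) n ` A'')"
  shows "c \<in> cells n A' \<and> c \<subseteq> {..<n} \<or> (\<exists>d\<in>cells m A''. c = (+) n ` d)"
proof -
  consider a where "a \<in> A'" "c = {a}" | a where "a \<in> A''" "c = {n + a}"
    | k where "k \<notin> A'" "k \<notin> (+) n ` A''" "k + 1 < n + m" "c = {k, k + 1}"
    using assms(3) by (auto simp: cells_def)
  then show ?thesis
  proof cases
    case 1
    then show ?thesis using assms(1) by (auto simp: cells_def)
  next
    case 2
    then have "{a} \<in> cells m A''" by (auto simp: cells_def)
    then show ?thesis using 2 by (intro disjI2 bexI[of _ "{a}"]) auto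
  next
    case 3
    show ?thesis
    proof (cases "k < n")
      case True
      then have "k + 1 < n" using 3(1) assms(2) by (cases "k = n - 1") auto
      then show ?thesis using 3 by (auto simp: cells_def)
    next
      case False
      then obtain j where j: "k = n + j" using le_Suc_ex not_less by blast
      then have "{j, j + 1} \<in> cells m A''" using 3 by (auto simp: cells_def)
      then show ?thesis using 3 j by (intro disjI2 bexI[of _ "{j, j + 1}"]) auto
    qed
  qed
qed

text \<open>
  Since every cell lies on one side of the cut, restricting a tiling to either side again gives a
  tiling by cells; conversely tilings of the two sides can be put together, the two sides being
  disjoint.
\<close>

lemma tilable_add_iff:
  assumes A': "A' \<subseteq> {..<n}" "n - 1 \<in> A'"
    and BC: "B \<subseteq> {..<n}" "C \<subseteq> {..<m}"
  shows "B \<union> (+) n ` C \<in> tilable (n + m) (A' \<union> (+) n ` A'')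
    \<longleftrightarrow> B \<in> tilable n A' \<and> C \<in> tilable m A''"
    (is "_ \<in> tilable _ ?A \<longleftrightarrow> _")
proof -
  let ?D = "B \<union> (+) n ` C"
  have low: "{..<n} \<inter> ?D = B" and high: "(+) n -` ?D = C" using BC by auto
  show ?thesis
  proof
    assume "?D \<in> tilable (n + m) ?A"
    then obtain P where P: "partition_on ?D P" "P \<subseteq> cells (n + m) ?A"
      unfolding tilable_def by blast
    \<comment> \<open>Cutting the tiles at \<open>n\<close> changes none of them, apart from producing empty pieces.\<close>
    have pieces: "({..<n} \<inter> c = {} \<or> {..<n} \<inter> c \<in> cells n A') \<and>
        ((+) n -` c = {} \<or> (+) n -` c \<in> cells m A'')" if "c \<in> P" for c
    proof -
      consider "c \<in> cells n A'" "c \<subseteq> {..<n}" | d where "d \<in> cells m A''" "c = (+) n ` d"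
        using cells_add_cases[OF A', of c m A''] P(2) \<open>c \<in> P\<close> by blast
      then show ?thesis
      proof cases
        case 1
        then have "{..<n} \<inter> c = c" "(+) n -` c = {}" by auto
        then show ?thesis using 1 by simp
      next
        case 2
        then have "{..<n} \<inter> c = {}" "(+) n -` c = d" by auto
        then show ?thesis using 2 by simp
      qed
    qed
    have "(\<inter>) {..<n} ` P - {{}} \<subseteq> cells n A'" "(-`) ((+) n) ` P - {{}} \<subseteq> cells m A''"
      using pieces by blast+
    moreover have "partition_on B ((\<inter>) {..<n} ` P - {{}})"
      using partition_on_restrict[OF P(1), of "{..<n}"] unfolding low .
    moreover have "partition_on C ((-`) ((+) n) ` P - {{}})"
      using partition_on_vimage[OF P(1), of "(+) n"] unfolding high .
    ultimately show "B \<in> tilable n A' \<and> C \<in> tilable m A''"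
      using BC unfolding tilable_def by blast
  next
    assume "B \<in> tilable n A' \<and> C \<in> tilable m A''"
    then obtain P Q where P: "partition_on B P" "P \<subseteq> cells n A'"
      and Q: "partition_on C Q" "Q \<subseteq> cells m A''"
      unfolding tilable_def by blast
    have "B \<subseteq> {..<n + m}" "(+) n ` C \<subseteq> {..<n + m}" using BC by auto
    moreover have "partition_on ((+) n ` C) ((`) ((+) n) ` Q - {{}})"
      using Q(1) by (intro partition_on_inj_image) auto
    moreover have "P \<subseteq> cells (n + m) ?A" "(`) ((+) n) ` Q - {{}} \<subseteq> cells (n + m) ?A"
      using P(2) Q(2) cells_add_left[OF A'(1), of m A''] cells_add_right[OF A'(1), of m A'']
      by blast+
    ultimately have "B \<in> tilable (n + m) ?A" "(+) n ` C \<in> tilable (n + m) ?A"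
      using P(1) unfolding tilable_def by blast+
    moreover have "B \<inter> (+) n ` C = {}" using BC by auto
    ultimately show "?D \<in> tilable (n + m) ?A" by (rule tilable_Un)
  qed
qed

lemma tiling_sum_add:
  assumes A': "A' \<subseteq> {..<n}" "n - 1 \<in> A'"
  shows "tiling_sum (n + m) (A' \<union> (+) n ` A'') Y
    = tiling_sum n A' Y * tiling_sum m A'' (\<lambda>i. Y (n + i))"
    (is "tiling_sum _ ?A _ = _")
proof -
  let ?join = "\<lambda>(B, C). B \<union> (+) n ` C"
  let ?split = "\<lambda>D. (D \<inter> {..<n}, {i. n + i \<in> D})"
  have sub: "B \<subseteq> {..<k}" if "B \<in> tilable k A" for B k A
    using that by (simp add: tilable_def)
  have split: "?split (B \<union> (+) n ` C) = (B, C)" if "B \<subseteq> {..<n}" for B C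
    using that by auto
  have join: "D \<inter> {..<n} \<union> (+) n ` {i. n + i \<in> D} = D" for D
  proof -
    have "x \<in> (+) n ` {i. n + i \<in> D}" if "x \<in> D" "\<not> x < n" for x
      using that by (intro image_eqI[of _ _ "x - n"]) auto
    then show ?thesis by auto
  qed
  have monomial: "(\<Prod>i\<in>{..<n + m} - (B \<union> (+) n ` C). Y i)
      = (\<Prod>i\<in>{..<n} - B. Y i) * (\<Prod>i\<in>{..<m} - C. Y (n + i))"
    if "B \<subseteq> {..<n}" for B C
  proof -
    have range: "{..<n + m} = {..<n} \<union> (+) n ` {..<m}"
    proof -
      have "{..<n + m} \<inter> {..<n} = {..<n}" "{i. n + i \<in> {..<n + m}} = {..<m}" by auto
      then show ?thesis using join[of "{..<n + m}"] by simp
    qed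
    have "{..<n + m} - (B \<union> (+) n ` C) = ({..<n} - B) \<union> (+) n ` ({..<m} - C)"
      unfolding range using that by auto
    moreover have "({..<n} - B) \<inter> (+) n ` ({..<m} - C) = {}" by auto
    ultimately show ?thesis by (simp add: prod.union_disjoint prod.reindex)
  qed
  have "tiling_sum n A' Y * tiling_sum m A'' (\<lambda>i. Y (n + i))
      = (\<Sum>(B, C)\<in>tilable n A' \<times> tilable m A''.
          (\<Prod>i\<in>{..<n} - B. Y i) * (\<Prod>i\<in>{..<m} - C. Y (n + i)))"
    unfolding tiling_sum_def by (simp add: sum_product sum.cartesian_product)
  also have "\<dots> = (\<Sum>D\<in>tilable (n + m) ?A. \<Prod>i\<in>{..<n + m} - D. Y i)"
  proof (rule sum.reindex_bij_witness[of _ ?split ?join])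
    fix x assume "x \<in> tilable n A' \<times> tilable m A''"
    then obtain B C where x: "x = (B, C)" "B \<in> tilable n A'" "C \<in> tilable m A''" by auto
    show "?split (?join x) = x" using split[OF sub[OF x(2)]] x(1) by simp
    show "?join x \<in> tilable (n + m) ?A"
      using tilable_add_iff[OF A' sub[OF x(2)] sub[OF x(3)]] x by simp
    show "(\<Prod>i\<in>{..<n + m} - ?join x. Y i)
        = (case x of (B, C) \<Rightarrow> (\<Prod>i\<in>{..<n} - B. Y i) * (\<Prod>i\<in>{..<m} - C. Y (n + i)))"
      using monomial[OF sub[OF x(2)]] x(1) by simp
  next
    fix D assume D: "D \<in> tilable (n + m) ?A"
    show "?join (?split D) = D" using join by simp
    have "{i. n + i \<in> D} \<subseteq> {..<m}" using sub[OF D] by auto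
    then show "?split D \<in> tilable n A' \<times> tilable m A''"
      using tilable_add_iff[OF A', of "D \<inter> {..<n}" "{i. n + i \<in> D}" m A''] D join[of D] by simp
  qed
  finally show ?thesis unfolding tiling_sum_def by simp
qed


section \<open>The cuts of simple sequences\<close>

text \<open>
  Stated on lists of pieces, the set \<open>A(\<tau>)\<close> can be computed from one simple sequence to the next,
  without returning to the factorization of a sequence of integers.
\<close>

definition cuts :: "piece list \<Rightarrow> nat set" where
  "cuts ps = {j. \<exists>i k m. Suc i < length ps \<and> ps ! i = Sing k \<and> ps ! Suc i = Reg m \<and>
     j = length (filter is_sing (take i ps))}"

lemma A_set_eq_cuts: "factorization \<tau> ps \<Longrightarrow> A_set \<tau> = cuts ps"
  by (simp add: A_set_def cuts_def pieces_eq)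

lemma filter_is_sing_map: "filter is_sing (map Sing ks) = map Sing ks"
  by (induction ks) auto

lemma cuts_simple_append:
  assumes "ks \<noteq> []"
  shows "cuts (map Sing ks @ Reg m # ps) = insert (length ks - 1) ((+) (length ks) ` cuts ps)"
    (is "cuts ?qs = insert (?n - 1) _")
proof (intro equalityI subsetI)
  fix j assume "j \<in> cuts ?qs"
  then obtain i k m' where i: "Suc i < length ?qs" "?qs ! i = Sing k" "?qs ! Suc i = Reg m'"
    and j: "j = length (filter is_sing (take i ?qs))"
    unfolding cuts_def by blast
  consider "Suc i < ?n" | "Suc i = ?n" | "i = ?n" | l where "i = Suc (?n + l)"
    using less_iff_Suc_add by (metis linorder_neqE_nat not_less_eq)
  then show "j \<in> insert (?n - 1) ((+) ?n ` cuts ps)"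
  proof cases
    case 1
    then show ?thesis using i(3) by (simp add: nth_append)
  next
    case 2
    then have "i = ?n - 1" "i \<le> ?n" by simp_all
    then show ?thesis using j by (simp add: take_map filter_is_sing_map)
  next
    case 3
    then show ?thesis using i(2) by (simp add: nth_append)
  next
    case 4
    then have "length (filter is_sing (take l ps)) \<in> cuts ps"
      using i by (auto simp: cuts_def nth_append)
    moreover have "j = ?n + length (filter is_sing (take l ps))"
      using 4 j by (simp add: filter_is_sing_map)
    ultimately show ?thesis by blast
  qed
next
  fix j assume "j \<in> insert (?n - 1) ((+) ?n ` cuts ps)"
  then consider "j = ?n - 1"
    | i k m' where "Suc i < length ps" "ps ! i = Sing k" "ps ! Suc i = Reg m'"
        "j = ?n + length (filter is_sing (take i ps))"
    unfolding cuts_def by blast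
  then show "j \<in> cuts ?qs"
  proof cases
    case 1
    obtain n where n: "?n = Suc n" using assms by (cases ks) auto
    then have "j = length (filter is_sing (take n ?qs))" using 1
      by (simp add: take_map filter_is_sing_map)
    moreover have "Suc n < length ?qs" "?qs ! n = Sing (ks ! n)" "?qs ! Suc n = Reg m"
      using n by (simp_all add: nth_append)
    ultimately show ?thesis unfolding cuts_def by blast
  next
    case 2
    let ?i = "Suc (?n + i)"
    have "Suc ?i < length ?qs" "?qs ! ?i = Sing k" "?qs ! Suc ?i = Reg m'"
      "j = length (filter is_sing (take ?i ?qs))"
      using 2 by (simp_all add: nth_append filter_is_sing_map)
    then show ?thesis unfolding cuts_def by blast
  qed
qed

lemma cuts_Nil: "cuts [] = {}"
  by (simp add: cuts_def)


section \<open>Multiplicativity of \<open>\<Delta>\<close>\<close>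

lemma Delta_eq_tiling_sum:
  assumes "num_sing \<tau> = N" "A_set \<tau> = A" "A \<subseteq> {..<N}" "N - 1 \<in> A"
  shows "Delta \<tau> Y = tiling_sum N A Y"
  using assms by (simp add: Delta_def P_poly_add_1)

theorem lemma4p36:
  fixes ks' ks'' :: "nat list" and m' m'' N' :: nat and \<sigma>' \<sigma>'' :: "nat list"
  assumes "ks' \<noteq> []" and "\<forall>k\<in>set ks'. 1 \<le> k" and "1 \<le> m'"
    and "ks'' \<noteq> []" and "\<forall>k\<in>set ks''. 1 \<le> k" and "1 \<le> m''"
    and "\<sigma>' = simple_seq ks' m'" and "\<sigma>'' = simple_seq ks'' m''"
    and "N' = length ks'"
  shows "Delta (\<sigma>' @ \<sigma>'') indet = Delta \<sigma>' indet * Delta \<sigma>'' (\<lambda>i. indet (N' + i))"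
proof -
  define N'' where "N'' = length ks''"
  have pos: "0 < N'" "0 < N''" using assms by (simp_all add: N''_def)
  have num: "num_sing \<sigma>' = N'" "num_sing \<sigma>'' = N''" "num_sing (\<sigma>' @ \<sigma>'') = N' + N''"
    using num_sing_simple_append[OF assms(1-6)] num_sing_simple_append(1)[OF assms(4-6) assms(1-3)]
      assms(7-9) by (simp_all add: N''_def)
  have A: "A_set \<sigma>' = {N' - 1}" "A_set \<sigma>'' = {N'' - 1}"
    "A_set (\<sigma>' @ \<sigma>'') = insert (N' - 1) ((+) N' ` {N'' - 1})"
    using A_set_eq_cuts[OF factorization_simple_append(1)[OF assms(1-6)]]
      A_set_eq_cuts[OF factorization_simple_append(1)[OF assms(4-6) assms(1-3)]]
      A_set_eq_cuts[OF factorization_simple_append(2)[OF assms(1-6)]]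
      assms(1,4,7-9)
    by (simp_all add: cuts_simple_append cuts_Nil N''_def insert_commute)
  have "Delta (\<sigma>' @ \<sigma>'') indet
      = tiling_sum (N' + N'') ({N' - 1} \<union> (+) N' ` {N'' - 1}) indet"
    using num(3) A(3) pos by (intro Delta_eq_tiling_sum) auto
  also have "\<dots> = tiling_sum N' {N' - 1} indet * tiling_sum N'' {N'' - 1} (\<lambda>i. indet (N' + i))"
    using pos by (intro tiling_sum_add) auto
  also have "\<dots> = Delta \<sigma>' indet * Delta \<sigma>'' (\<lambda>i. indet (N' + i))"
    using pos Delta_eq_tiling_sum[OF num(1) A(1), of indet]
      Delta_eq_tiling_sum[OF num(2) A(2), of "\<lambda>i. indet (N' + i)"] by simp
  finally show ?thesis .
qed

end
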